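(* Let $B=[(b_1,v_1),\dots,(b_n,v_n)]$ be a bid-velocity multi-set and assume that its evolution under $T^\gamma$ is periodic, in the sense that there exist $N\in\mathbb{Z}$ and $\kappa\in\mathbb{N}$, $\kappa\ge1$, such that $$(T^\gamma)^\kappa(B)=B+N\gamma:=[(b_1+N\gamma,v_1),\dots,(b_n+N\gamma,v_n)].$$ Then $$\frac{N}{\kappa}=\frac{w-\ell}{\sum_{i=1}^n\frac1{v_i}} .$$
   Context: Let $n\in\mathbb{N}$ be the number of bidders, $\gamma>0$ the inverse of a natural number, $p\in[0,1]$ with $np\in\mathbb{N}$; $w=np$ and $\ell=n(1-p)$ are the numbers of winners and losers at each step. A bid-velocity multi-set is $B=[(b_1,v_1),\dots,(b_n,v_n)]$ with $b_1\le\dots\le b_n$, $b_i\in\gamma\mathbb{Z}$ (initially in $[0,1]$), $v_i$ positive integers. One step of the dynamics: set $b'_i=b_i+\gamma v_i(\mathbf{1}\{0<i\le np\}-\mathbf{1}\{np<i\le n\})$, let $\sigma$ be a permutation of $\{1,\dots,n\}$ with $b'_{\sigma_1}\le\dots\le b'_{\sigma_n}$, and define $T^\gamma B=[(b'_{\sigma_1},v_{\sigma_1}),\dots,(b'_{\sigma_n},v_{\sigma_n})]$. Thus the $np$ lowest bidders (winners) move up by $\gamma$ times their velocity and the others (losers) move down by $\gamma$ times their velocity; each bidder keeps its velocity. *)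

theory Defs
  imports Complex_Main "HOL-Library.Multiset" "HOL-Combinatorics.Combinatorics"
begin

text \<open>
  A bid-velocity multi-set is represented by a listing \<open>[(b\<^sub>1,v\<^sub>1), \<dots>, (b\<^sub>n,v\<^sub>n)]\<close> with nondecreasing
  bids. The listing is unique only up to reordering of pairs with equal bids. The requirement that
  the bids lie in \<open>[0,1]\<close> concerns the start of the dynamics only, is not preserved by a step, and is
  not part of the notion.
\<close>
definition bv_multiset :: "real \<Rightarrow> (real \<times> nat) list \<Rightarrow> bool" where
  "bv_multiset \<gamma> B \<longleftrightarrow>
     sorted (map fst B) \<and> (\<forall>(b, v)\<in>set B. (\<exists>k::int. b = \<gamma> * of_int k) \<and> v > 0)"

text \<open>List positions start at 0, so the \<open>w\<close> lowest bidders are at the positions \<open>i < w\<close>.\<close>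
definition move_bids :: "real \<Rightarrow> nat \<Rightarrow> (real \<times> nat) list \<Rightarrow> (real \<times> nat) list" where
  "move_bids \<gamma> w B =
     map (\<lambda>i. case B ! i of (b, v) \<Rightarrow> (b + \<gamma> * real v * (if i < w then 1 else -1), v))
       [0..<length B]"

text \<open>
  The sorting permutation \<open>\<sigma>\<close> is not unique when bids coincide, and its choice can affect who wins
  in the next step. The map \<open>T\<^sup>\<gamma>\<close> is therefore a relation that allows every choice of \<open>\<sigma>\<close>; it contains
  the graph of the map for any particular tie-breaking rule.
\<close>
definition bv_step :: "real \<Rightarrow> nat \<Rightarrow> (real \<times> nat) list \<Rightarrow> (real \<times> nat) list \<Rightarrow> bool" where
  "bv_step \<gamma> w B B' \<longleftrightarrow>
     (\<exists>\<sigma>. \<sigma> permutes {..<length B} \<and> B' = permute_list \<sigma> (move_bids \<gamma> w B) \<and> sorted (map fst B'))"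

definition shift_bids :: "real \<Rightarrow> (real \<times> nat) list \<Rightarrow> (real \<times> nat) list" where
  "shift_bids c B = map (\<lambda>(b, v). (b + c, v)) B"

end

theory Submission
  imports Defs
begin

text \<open>
  The potential \<open>\<Sum>i. b\<^sub>i / v\<^sub>i\<close> ignores the order of the list, and each step raises it by
  \<open>\<gamma> (w - l)\<close>, because every winner contributes \<open>\<gamma>\<close> and every loser \<open>-\<gamma>\<close> whatever its velocity.
  Shifting all bids by \<open>N \<gamma>\<close> raises it by \<open>N \<gamma> \<Sum>i. 1 / v\<^sub>i\<close>. Comparing both over a period
  gives the claim; bidders need not be tracked individually.
\<close>

text \<open>Taking a multiset as argument hides the choice of \<open>\<sigma>\<close> in each step
  and matches the periodicity assumption, which is an equality of multisets.\<close>

definition bid_potential :: "(real \<times> nat) multiset \<Rightarrow> real" where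
  "bid_potential M = (\<Sum>(b, v)\<in>#M. b / real v)"

lemma bid_potential_mset: "bid_potential (mset B) = (\<Sum>(b, v)\<leftarrow>B. b / real v)"
  by (simp add: bid_potential_def flip: sum_mset_sum_list)

lemma bv_step_mset:
  assumes "bv_step \<gamma> w B B'"
  shows "mset B' = mset (move_bids \<gamma> w B)"
  using assms by (auto simp: bv_step_def move_bids_def)

lemma map_snd_move_bids: "map snd (move_bids \<gamma> w B) = map snd B"
  by (rule nth_equalityI) (auto simp: move_bids_def split: prod.splits)

text \<open>The velocity cancels in \<open>\<gamma> * v / v\<close>. This fails for
  \<open>v = 0\<close>, where HOL division yields 0, hence the second assumption; the first makes
  the truncated \<open>length B - w\<close> the true number of losers.\<close>

lemma bid_potential_move_bids:
  assumes "w \<le> length B" and "0 \<notin> set (map snd B)"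
  shows "bid_potential (mset (move_bids \<gamma> w B)) =
           bid_potential (mset B) + \<gamma> * (real w - real (length B - w))"
proof -
  let ?n = "length B"
  have v: "snd (B ! i) \<noteq> 0" if "i < ?n" for i
    using that assms(2) by (metis image_eqI list.set_map nth_mem)
  have "bid_potential (mset (move_bids \<gamma> w B)) =
      (\<Sum>i<?n. fst (B ! i) / real (snd (B ! i)) + \<gamma> * (if i < w then 1 else -1))"
    unfolding bid_potential_mset sum_list_sum_nth
  proof (rule sum.cong)
    fix i
    assume "i \<in> {..<?n}"
    then show "map (\<lambda>(b, v). b / real v) (move_bids \<gamma> w B) ! i =
        fst (B ! i) / real (snd (B ! i)) + \<gamma> * (if i < w then 1 else -1)"
      using v[of i] by (cases "B ! i") (simp add: move_bids_def field_simps)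
  qed (simp add: move_bids_def atLeast0LessThan)
  also have "\<dots> = bid_potential (mset B) + \<gamma> * (\<Sum>i<?n. if i < w then 1 else -1)"
    by (simp add: bid_potential_mset sum_list_sum_nth sum.distrib sum_distrib_left
        case_prod_unfold atLeast0LessThan)
  also have "(\<Sum>i<?n. if i < w then 1 else - 1) = real w - real (?n - w)"
  proof -
    have "{..<?n} \<inter> {i. i < w} = {..<w}" "{..<?n} \<inter> - {i. i < w} = {w..<?n}"
      using assms(1) by auto
    then show ?thesis
      by (simp add: sum.If_cases)
  qed
  finally show ?thesis .
qed

text \<open>The multiset of velocities is carried through the induction since it fixes the length
  and keeps velocities nonzero, so that the one-step identity applies to every intermediate
  list.\<close>

lemma bid_potential_iterate:
  assumes "(bv_step \<gamma> w ^^ k) B B'" and "w \<le> length B" and "0 \<notin> set (map snd B)"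
  shows "image_mset snd (mset B') = image_mset snd (mset B)" (is ?A)
    and "bid_potential (mset B') =
           bid_potential (mset B) + real k * \<gamma> * (real w - real (length B - w))" (is ?B)
proof -
  from assms(1) have "?A \<and> ?B"
  proof (induction k arbitrary: B')
    case 0
    then show ?case by simp
  next
    case (Suc k)
    then obtain C where C: "(bv_step \<gamma> w ^^ k) B C" "bv_step \<gamma> w C B'"
      by auto
    note IH = Suc.IH[OF C(1)]
    then have len: "length C = length B"
      by (metis size_image_mset size_mset)
    have "set (map snd C) = set (map snd B)"
      using IH by (metis mset_map set_mset_mset)
    then have "bid_potential (mset B') =
        bid_potential (mset C) + \<gamma> * (real w - real (length B - w))"
      using bid_potential_move_bids[of w C \<gamma>] assms(2,3) len bv_step_mset[OF C(2)] by simp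
    moreover have "image_mset snd (mset B') = image_mset snd (mset C)"
      by (metis bv_step_mset[OF C(2)] map_snd_move_bids mset_map)
    ultimately show ?case
      using IH by (simp add: algebra_simps)
  qed
  then show ?A ?B by auto
qed

lemma bid_potential_shift_bids:
  "bid_potential (mset (shift_bids c B)) =
     bid_potential (mset B) + c * (\<Sum>i<length B. 1 / real (snd (B ! i)))"
  unfolding bid_potential_mset
  by (simp add: shift_bids_def sum_list_sum_nth case_prod_unfold
      add_divide_distrib sum.distrib sum_distrib_left atLeast0LessThan)

theorem proposition6p1:
  fixes n m w l \<kappa> :: nat and \<gamma> p :: real and N :: int
    and B B' :: "(real \<times> nat) list"
  assumes "n \<ge> 1"
    and "m \<ge> 1" and "\<gamma> = 1 / real m"
    and "0 \<le> p" and "p \<le> 1"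
    and "real w = real n * p" and "real l = real n * (1 - p)"
    and "bv_multiset \<gamma> B" and "length B = n"
    and "\<kappa> \<ge> 1"
    and "(bv_step \<gamma> w ^^ \<kappa>) B B'"
    and "mset B' = mset (shift_bids (of_int N * \<gamma>) B)"
  shows "of_int N / real \<kappa> = (real w - real l) / (\<Sum>i<n. 1 / real (snd (B ! i)))"
proof -
  let ?S = "\<Sum>i<n. 1 / real (snd (B ! i))"
  have "real w + real l = real n"
    using assms(6,7) by (simp add: algebra_simps)
  then have wl: "w \<le> length B" "length B - w = l"
    using assms(9) by linarith+
  have v: "0 \<notin> set (map snd B)"
    using assms(8) by (auto simp: bv_multiset_def)
  \<comment> \<open>The potential of \<open>B'\<close> is computed once along the
    \<open>\<kappa>\<close> steps and once from the shift; that of \<open>B\<close> cancels.\<close>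
  have "of_int N * \<gamma> * ?S = real \<kappa> * \<gamma> * (real w - real l)"
    using bid_potential_iterate(2)[OF assms(11) wl(1) v]
      bid_potential_shift_bids[of "of_int N * \<gamma>" B] wl(2) assms(9,12) by simp
  then have "\<gamma> * (of_int N * ?S) = \<gamma> * (real \<kappa> * (real w - real l))"
    by (simp only: ac_simps)
  moreover have "\<gamma> \<noteq> 0"
    using assms(2,3) by simp
  ultimately have eq: "of_int N * ?S = real \<kappa> * (real w - real l)"
    by (simp only: mult_cancel_left simp_thms)
  have "snd (B ! i) \<noteq> 0" if "i < n" for i
    using that v assms(9) by (metis image_eqI list.set_map nth_mem)
  \<comment> \<open>Positivity, from \<open>n \<ge> 1\<close> and nonzero velocities, permits the
    final division by \<open>?S\<close>.\<close>
  then have "?S > 0"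
    using assms(1) by (intro sum_pos) (auto simp: lessThan_empty_iff)
  then show ?thesis
    using eq assms(10) by (simp add: field_simps)
qed

end
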